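(* Let $g(x,z)=\exp((x^2+1)\ln z)=z^{x^2+1}$ for $z>0$. Let $W\subset\mathbb{R}^3$ be the graph $\{(x,y,z): y=g(x,z)\}$ of $g$ for $z>0$ and $x$, $z$ small, and let $X$ be the $x$-axis. Then Kuo's ratio test $(r)$ fails for the pair of strata $(W,X)$ at $(0,0,0)$.
   Context: For linear subspaces $E,F$ set $\delta(E,F)=\sup_{u\in E,|u|=1}d(u,F)$. Kuo's ratio test $(r)$ holds for $(W,X)$ at $(0,0,0)$ if $$R(x,y,z)=\frac{|(x,y,z)|\,\delta(T_{(x,0,0)}X,\,T_{(x,y,z)}W)}{|(y,z)|}\to 0$$ as $(x,y,z)$ tends to $(0,0,0)$ on $W$. *)

theory Defs
  imports "HOL-Analysis.Analysis"
begin

text \<open>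
  Euclidean 3-space is rendered as the type \<open>real \<times> real \<times> real\<close>, whose library norm is the
  Euclidean one; likewise \<open>norm (y, z)\<close> is the Euclidean norm on the plane.
\<close>

text \<open>
  The tangent space of a \<open>C\<^sup>1\<close> submanifold at one of its points: all velocity vectors of
  \<open>C\<^sup>1\<close> curves that stay in \<open>M\<close> and pass through \<open>p\<close> at time 0.
\<close>

definition tangent_space :: "'a::real_normed_vector set \<Rightarrow> 'a \<Rightarrow> 'a set" where
  "tangent_space M p =
    {v. \<exists>\<gamma> e. 0 < e \<and> \<gamma> C1_differentiable_on {-e<..<e} \<and> \<gamma> ` {-e<..<e} \<subseteq> M \<and>
         \<gamma> 0 = p \<and> (\<gamma> has_vector_derivative v) (at (0::real))}"

text \<open>
  To be used for linear subspaces \<open>E\<close>, \<open>F\<close> with \<open>E\<close> nonzero: then the supremum is over a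
  nonempty set of reals, bounded by 1.
\<close>

definition subspace_delta :: "'a::real_normed_vector set \<Rightarrow> 'a set \<Rightarrow> real" where
  "subspace_delta E F = (SUP u \<in> {u \<in> E. norm u = 1}. infdist u F)"

definition kuo_ratio ::
  "(real \<times> real \<times> real) set \<Rightarrow> (real \<times> real \<times> real) set \<Rightarrow> real \<times> real \<times> real \<Rightarrow> real" where
  "kuo_ratio W X = (\<lambda>(x, y, z).
     norm (x, y, z) * subspace_delta (tangent_space X (x, 0, 0)) (tangent_space W (x, y, z))
       / norm (y, z))"

definition kuo_ratio_test ::
  "(real \<times> real \<times> real) set \<Rightarrow> (real \<times> real \<times> real) set \<Rightarrow> bool" where
  "kuo_ratio_test W X \<longleftrightarrow> (kuo_ratio W X \<longlongrightarrow> 0) (at (0, 0, 0) within W)"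

definition x_axis :: "(real \<times> real \<times> real) set" where
  "x_axis = {(x, y, z). y = 0 \<and> z = 0}"

definition g :: "real \<Rightarrow> real \<Rightarrow> real" where
  "g x z = exp ((x\<^sup>2 + 1) * ln z)"

lemma g_eq_powr: "0 < z \<Longrightarrow> g x z = z powr (x\<^sup>2 + 1)"
  by (simp add: g_def powr_def)

text \<open>
  The parameter \<open>U\<close> is the neighbourhood of the origin of the \<open>(x, z)\<close>-plane that makes
  precise what it means for \<open>x\<close> and \<open>z\<close> to be small.
\<close>

definition g_graph :: "(real \<times> real) set \<Rightarrow> (real \<times> real \<times> real) set" where
  "g_graph U = {(x, y, z). (x, z) \<in> U \<and> 0 < z \<and> y = g x z}"

end

theory Submission
  imports Defs "HOL-Real_Asymp.Real_Asymp"
begin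

text \<open>
  On the curve \<open>x = 1/n\<close>, \<open>z = exp (- n\<^sup>2)\<close> one has \<open>x\<^sup>2 ln z = -1\<close>, so \<open>g\<close> stays proportional to
  \<open>z\<close>, while the slope \<open>\<partial>g/\<partial>x = 2 x g ln z\<close> has size \<open>2 n z / exp 1\<close>. Up to a constant the slope
  bounds \<open>\<delta>\<close> from below, and the factor \<open>1/n\<close> coming from the norm of the point leaves a ratio
  bounded away from 0.
\<close>

lemma zero_in_tangent_space:
  assumes "p \<in> M"
  shows "0 \<in> tangent_space M p"
  unfolding tangent_space_def using assms
  by (auto intro!: exI[of _ "\<lambda>_. p"] exI[of _ "1::real"] C1_differentiable_on_eq[THEN iffD2])

text \<open>The unit vector at which the supremum in \<open>subspace_delta\<close> is tested; a
  single one suffices for a lower bound.\<close>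

lemma x_axis_direction_in_tangent_space: "(1, 0, 0) \<in> tangent_space x_axis (x, 0, 0)"
proof -
  have "((\<lambda>t. (x + t, 0, 0)) has_vector_derivative (1, 0, 0)) (at t)" for t :: real
    by (auto intro!: derivative_eq_intros has_vector_derivative_Pair
        simp flip: has_real_derivative_iff_has_vector_derivative zero_prod_def)
  then show ?thesis
    unfolding tangent_space_def C1_differentiable_on_def x_axis_def
    by (intro CollectI exI[of _ "\<lambda>t. (x + t, 0, 0)"] exI[of _ "1::real"] conjI
        exI[of _ "\<lambda>_. (1, 0, 0)"]) auto
qed

text \<open>The chain rule applied to \<open>Y t = g (X t) (Z t)\<close> at time 0. Inclusion in
  this plane is enough: the distance to a nonempty subset is at least the distance to the
  plane.\<close>

lemma tangent_space_g_graph: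
  assumes "(a, b, c) \<in> tangent_space (g_graph U) (x, y, z)"
  shows "b = g x z * (2 * x * ln z * a + (x\<^sup>2 + 1) / z * c)"
proof -
  obtain \<gamma> e where e: "0 < e" "\<gamma> ` {-e<..<e} \<subseteq> g_graph U" "\<gamma> 0 = (x, y, z)"
    and D: "(\<gamma> has_vector_derivative (a, b, c)) (at (0::real))"
    using assms unfolding tangent_space_def by auto
  define X Y Z where "X t = fst (\<gamma> t)" and "Y t = fst (snd (\<gamma> t))" and "Z t = snd (snd (\<gamma> t))" for t
  have G: "0 < Z t" "Y t = g (X t) (Z t)" if "\<bar>t\<bar> < e" for t
  proof -
    have "\<gamma> t \<in> g_graph U" using e(2) that by (auto simp: image_subset_iff abs_less_iff)
    then show "0 < Z t" "Y t = g (X t) (Z t)"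
      by (auto simp: g_graph_def X_def Y_def Z_def)
  qed
  have z: "0 < z" using G(1)[of 0] e by (simp add: Z_def)
  have X: "(X has_real_derivative a) (at 0)"
    using bounded_linear.has_vector_derivative[OF bounded_linear_fst D]
    by (simp add: X_def[abs_def] has_real_derivative_iff_has_vector_derivative)
  have Dyz: "((\<lambda>t. snd (\<gamma> t)) has_vector_derivative (b, c)) (at 0)"
    using bounded_linear.has_vector_derivative[OF bounded_linear_snd D] by simp
  have Y: "(Y has_real_derivative b) (at 0)"
    using bounded_linear.has_vector_derivative[OF bounded_linear_fst Dyz]
    by (simp add: Y_def[abs_def] has_real_derivative_iff_has_vector_derivative)
  have Z: "(Z has_real_derivative c) (at 0)"
    using bounded_linear.has_vector_derivative[OF bounded_linear_snd Dyz]
    by (simp add: Z_def[abs_def] has_real_derivative_iff_has_vector_derivative)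
  have 0: "X 0 = x" "Z 0 = z" using e by (auto simp: X_def Z_def)
  have "((\<lambda>t. g (X t) (Z t)) has_real_derivative
      g x z * (2 * x * ln z * a + (x\<^sup>2 + 1) / z * c)) (at 0)"
    unfolding g_def using z
    by (auto intro!: derivative_eq_intros X Z simp: 0 algebra_simps add_divide_distrib)
  then have "(Y has_real_derivative g x z * (2 * x * ln z * a + (x\<^sup>2 + 1) / z * c)) (at 0)"
    by (rule has_field_derivative_transform_within_open[where S = "{-e<..<e}"])
      (use e G(2) in \<open>auto simp: abs_less_iff\<close>)
  then show ?thesis using Y by (rule DERIV_unique[symmetric])
qed

text \<open>As \<open>0\<close> lies in \<open>F\<close>, each unit vector has distance at most 1
  from \<open>F\<close>, so the supremum is over a bounded set.\<close>

lemma infdist_le_subspace_delta: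
  fixes E F :: "'a::real_normed_vector set"
  assumes "u \<in> E" "norm u = 1" "0 \<in> F"
  shows "infdist u F \<le> subspace_delta E F"
  unfolding subspace_delta_def
proof (rule cSUP_upper)
  show "bdd_above ((\<lambda>u. infdist u F) ` {u \<in> E. norm u = 1})"
    using infdist_le[OF \<open>0 \<in> F\<close>] by (auto intro!: bdd_aboveI[of _ 1] simp: dist_norm) (metis)
qed (use assms in auto)

text \<open>If \<open>v\<close> is at distance \<open>N\<close> from \<open>(1, 0, 0)\<close>, then
  \<open>1 - a\<close>, \<open>b\<close> and \<open>c\<close> are at most \<open>N\<close> in
  absolute value. Writing \<open>p\<close> in terms of these three yields
  \<open>\<bar>p\<bar> \<le> (\<bar>p\<bar> + 1 + \<bar>q\<bar>) * N\<close>. Nonemptiness excludes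
  the default value 0 of \<open>infdist\<close>.\<close>

lemma slope_le_infdist:
  fixes F :: "(real \<times> real \<times> real) set"
  assumes "F \<noteq> {}" and F: "\<And>a b c. (a, b, c) \<in> F \<Longrightarrow> b = p * a + q * c"
  shows "\<bar>p\<bar> / (\<bar>p\<bar> + 1 + \<bar>q\<bar>) \<le> infdist (1, 0, 0) F"
  unfolding infdist_notempty[OF \<open>F \<noteq> {}\<close>]
proof (rule cINF_greatest[OF \<open>F \<noteq> {}\<close>])
  fix v assume "v \<in> F"
  obtain a b c where v: "v = (a, b, c)" by (cases v)
  define N where "N = dist (1, 0, 0) v"
  have le: "\<bar>1 - a\<bar> \<le> N" "\<bar>b\<bar> \<le> N" "\<bar>c\<bar> \<le> N"
    by (auto simp: N_def v dist_norm norm_Pair intro!: real_le_rsqrt)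
  have "p = p * (1 - a) + b - q * c"
    using F \<open>v \<in> F\<close> by (simp add: v algebra_simps)
  then have "\<bar>p\<bar> \<le> \<bar>p * (1 - a)\<bar> + \<bar>b\<bar> + \<bar>q * c\<bar>" by linarith
  also have "\<dots> \<le> \<bar>p\<bar> * N + N + \<bar>q\<bar> * N"
    using le by (auto simp: abs_mult intro!: add_mono mult_left_mono)
  finally show "\<bar>p\<bar> / (\<bar>p\<bar> + 1 + \<bar>q\<bar>) \<le> dist (1, 0, 0) v"
    by (simp add: N_def pos_divide_le_eq add_pos_nonneg algebra_simps)
qed

text \<open>The three factors are estimated by \<open>1 / t\<close> for the norm of the point,
  \<open>t * y / 2\<close> for delta and \<open>2 * z\<close> for the denominator. The powers of
  \<open>t\<close> cancel and \<open>y / z = exp (-1)\<close> remains.\<close>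

lemma kuo_ratio_lower_bound:
  fixes t :: real
  assumes "1 \<le> t" and W: "(1 / t, exp (- t\<^sup>2 - 1), exp (- t\<^sup>2)) \<in> g_graph U"
  shows "exp (-1) / 4 \<le> kuo_ratio (g_graph U) x_axis (1 / t, exp (- t\<^sup>2 - 1), exp (- t\<^sup>2))"
proof -
  define y z where "y = exp (- t\<^sup>2 - 1)" and "z = exp (- t\<^sup>2)"
  \<comment> \<open>The partial derivatives of \<open>g\<close> in \<open>x\<close> and
    \<open>z\<close> at \<open>(1 / t, z)\<close>, simplified by \<open>ln z = - t\<^sup>2\<close>
    and \<open>y / z = exp (-1)\<close>.\<close>
  define p q where "p = - 2 * t * y" and "q = ((1 / t)\<^sup>2 + 1) * exp (-1)"
  let ?F = "tangent_space (g_graph U) (1 / t, y, z)"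
  have yz: "y = exp (-1) * z" "0 < y" "0 < z"
    by (auto simp: y_def z_def simp flip: exp_add)
  have g: "g (1 / t) z = y"
    using W by (simp add: g_graph_def y_def z_def)
  \<comment> \<open>Serves twice: \<open>?F\<close> is nonempty, and the supremum defining delta is
    bounded.\<close>
  have 0: "0 \<in> ?F" using zero_in_tangent_space[OF W] by (simp add: y_def z_def)
  have "\<bar>p\<bar> / (\<bar>p\<bar> + 1 + \<bar>q\<bar>) \<le> infdist (1, 0, 0) ?F"
  proof (rule slope_le_infdist)
    fix a b c assume "(a, b, c) \<in> ?F"
    from tangent_space_g_graph[OF this]
    have "b = y * (2 * (1 / t) * (- t\<^sup>2) * a + ((1 / t)\<^sup>2 + 1) / z * c)"
      unfolding g by (simp add: z_def)
    also have "\<dots> = y * (2 * (1 / t) * (- t\<^sup>2)) * a + ((1 / t)\<^sup>2 + 1) * (y / z) * c"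
      by (simp add: algebra_simps add_divide_distrib)
    also have "y * (2 * (1 / t) * (- t\<^sup>2)) = p"
      using assms by (simp add: p_def power2_eq_square)
    also have "((1 / t)\<^sup>2 + 1) * (y / z) = q"
      using yz by (simp add: q_def)
    finally show "b = p * a + q * c" .
  qed (use 0 in auto)
  also have "\<dots> \<le> subspace_delta (tangent_space x_axis (1 / t, 0, 0)) ?F"
    by (rule infdist_le_subspace_delta[OF x_axis_direction_in_tangent_space _ 0])
      (simp add: norm_Pair)
  finally have delta: "\<bar>p\<bar> / (\<bar>p\<bar> + 1 + \<bar>q\<bar>) \<le> subspace_delta (tangent_space x_axis (1 / t, 0, 0)) ?F" .
  \<comment> \<open>Together with \<open>\<bar>q\<bar> \<le> 2\<close> this keeps the denominator
    \<open>\<bar>p\<bar> + 1 + \<bar>q\<bar>\<close> below or equal to 4. It rests on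
    \<open>2 * t \<le> exp (t\<^sup>2 + 1)\<close>, whose right side is
    \<open>1 / y\<close>.\<close>
  have p: "\<bar>p\<bar> \<le> 1"
  proof -
    have "2 * t \<le> t\<^sup>2 + 1" using zero_le_power2[of "t - 1"] by (simp add: power2_eq_square algebra_simps)
    also have "\<dots> \<le> exp (t\<^sup>2 + 1)" using exp_ge_add_one_self[of "t\<^sup>2 + 1"] by linarith
    finally have "2 * t * y \<le> exp (t\<^sup>2 + 1) * y" using yz by (intro mult_right_mono) auto
    also have "\<dots> = 1" by (simp add: y_def flip: exp_add)
    finally show ?thesis using assms yz by (simp add: p_def abs_mult)
  qed
  have q: "\<bar>q\<bar> \<le> 2"
  proof -
    have "(1 / t)\<^sup>2 \<le> 1" using assms by (intro power_le_one) auto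
    then have "q \<le> 2 * 1" unfolding q_def by (intro mult_mono) auto
    moreover have "0 \<le> q" by (simp add: q_def)
    ultimately show ?thesis by simp
  qed
  have "\<bar>p\<bar> / 4 \<le> \<bar>p\<bar> / (\<bar>p\<bar> + 1 + \<bar>q\<bar>)"
    using p q by (intro divide_left_mono) (auto intro!: mult_pos_pos)
  with delta have delta: "\<bar>p\<bar> / 4 \<le> subspace_delta (tangent_space x_axis (1 / t, 0, 0)) ?F"
    by linarith
  have x: "1 / t \<le> norm (1 / t, y, z)" using norm_fst_le[of "1 / t" "(y, z)"] assms by simp
  have "norm (y, z) \<le> \<bar>y\<bar> + \<bar>z\<bar>" using norm_Pair_le[of y z] by simp
  also have "\<dots> \<le> 2 * z" using yz by (simp add: mult_le_cancel_right1)
  finally have yz2: "norm (y, z) \<le> 2 * z" .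
  have "exp (-1) / 4 = (1 / t) * (\<bar>p\<bar> / 4) / (2 * z)"
    using assms yz by (simp add: p_def abs_mult field_simps)
  also have "\<dots> \<le> norm (1 / t, y, z) * subspace_delta (tangent_space x_axis (1 / t, 0, 0)) ?F / norm (y, z)"
    using yz assms delta x yz2 by (intro frac_le mult_mono mult_nonneg_nonneg) (auto simp: zero_prod_def intro: order_trans[rotated])
  finally show ?thesis by (simp add: kuo_ratio_def y_def z_def)
qed

theorem mainTheorem10:
  fixes U :: "(real \<times> real) set"
  assumes "open U" and "(0, 0) \<in> U"
  shows "\<not> kuo_ratio_test (g_graph U) x_axis"
proof
  assume "kuo_ratio_test (g_graph U) x_axis"
  then have R: "(kuo_ratio (g_graph U) x_axis \<longlongrightarrow> 0) (at (0, 0, 0) within g_graph U)"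
    by (simp add: kuo_ratio_test_def)
  \<comment> \<open>The test curve, with a continuous parameter \<open>t\<close> in place of
    \<open>n\<close>.\<close>
  define w where "w t = (1 / t, exp (- t\<^sup>2 - 1), exp (- t\<^sup>2))" for t :: real
  have x: "((\<lambda>t::real. 1 / t) \<longlongrightarrow> 0) at_top"
    and y: "((\<lambda>t::real. exp (- t\<^sup>2 - 1)) \<longlongrightarrow> 0) at_top"
    and z: "((\<lambda>t::real. exp (- t\<^sup>2)) \<longlongrightarrow> 0) at_top"
    by real_asymp+
  have w0: "(w \<longlongrightarrow> (0, 0, 0)) at_top"
    unfolding w_def by (intro tendsto_Pair x y z)
  have "eventually (\<lambda>t. (1 / t, exp (- t\<^sup>2)) \<in> U) at_top"
    using assms by (intro topological_tendstoD[OF tendsto_Pair[OF x z]])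
  \<comment> \<open>For nonzero \<open>t\<close> the exponent
    \<open>((1 / t)\<^sup>2 + 1) * (- t\<^sup>2)\<close> equals \<open>- t\<^sup>2 - 1\<close>, so
    the curve lies on the graph.\<close>
  then have W: "eventually (\<lambda>t. w t \<in> g_graph U) at_top"
    using eventually_gt_at_top[of 0]
    by eventually_elim (auto simp: w_def g_graph_def g_def power2_eq_square field_simps)
  \<comment> \<open>The filter excludes the origin itself; \<open>w t\<close> avoids it because
    exponentials never vanish.\<close>
  have "filterlim w (at (0, 0, 0) within g_graph U) at_top"
    unfolding filterlim_at using w0 W by (auto simp: w_def elim: eventually_mono)
  from filterlim_compose[OF R this]
  have "eventually (\<lambda>t. kuo_ratio (g_graph U) x_axis (w t) < exp (-1) / 4) at_top"
    by (rule order_tendstoD) simp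
  moreover have "eventually (\<lambda>t. exp (-1) / 4 \<le> kuo_ratio (g_graph U) x_axis (w t)) at_top"
    using W eventually_ge_at_top[of 1]
    unfolding w_def by eventually_elim (rule kuo_ratio_lower_bound)
  ultimately have "eventually (\<lambda>t::real. False) at_top"
    by eventually_elim simp
  then show False by simp
qed

end
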